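(* Let $G$ be a connected graph of order $n$, and let $\mathcal{P}\subseteq\mathcal{L}(G)$ with $|\mathcal{P}|=3$. Then $f(G,\mathcal{P})\leq (n+6)/13$.
   Context: All graphs are finite and simple. For a connected graph $G$, $l(G)$ denotes the length (number of edges) of a longest path in $G$, and $\mathcal{L}(G)$ is the set of paths of $G$ with exactly $l(G)+1$ vertices (the longest paths). $d_G(x,y)$ is the distance between $x$ and $y$ in $G$, and for $U\subseteq V(G)$, $d_G(x,U)=\min\{d_G(x,y)\mid y\in U\}$. For $\mathcal{P}\subseteq\mathcal{L}(G)$, $f(G,\mathcal{P})=\min\{\sum_{P\in\mathcal{P}} d_G(v,V(P))\mid v\in V(G)\}$. *)

theory Defs
  imports Complex_Main "Graph_Theory.Graph_Theory"
begin

text \<open>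
  A finite simple graph is a \<open>pair_graph\<close>: each undirected edge is the pair of its two
  opposite arcs. A path is a subgraph, so the vertex sequence of a path and its reversal
  give one and the same path, whereas two paths with equal vertex sets but different edge
  sets are distinct.
\<close>

definition path_subgraph :: "'a vwalk \<Rightarrow> 'a pair_pre_digraph" where
  "path_subgraph p =
     \<lparr> pverts = set p, parcs = set (vwalk_arcs p) \<union> (set (vwalk_arcs p))\<inverse> \<rparr>"

definition paths :: "'a pair_pre_digraph \<Rightarrow> 'a pair_pre_digraph set" where
  "paths G = {path_subgraph p | p. vpath p (with_proj G)}"

definition longest_path_length :: "'a pair_pre_digraph \<Rightarrow> nat" where
  "longest_path_length G = Max {vwalk_length p | p. vpath p (with_proj G)}"

definition longest_paths :: "'a pair_pre_digraph \<Rightarrow> 'a pair_pre_digraph set" where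
  "longest_paths G = {P \<in> paths G. card (pverts P) = longest_path_length G + 1}"

text \<open>
  The distance is meaningful only for vertices joined by a path, the distance to a set only
  for finite nonempty sets, and the total distance below only for finite nonempty graphs.
\<close>

definition vdist :: "'a pair_pre_digraph \<Rightarrow> 'a \<Rightarrow> 'a \<Rightarrow> nat" where
  "vdist G x y =
     (LEAST k. \<exists>p. vpath p (with_proj G) \<and> hd p = x \<and> last p = y \<and> vwalk_length p = k)"

definition vdist_set :: "'a pair_pre_digraph \<Rightarrow> 'a \<Rightarrow> 'a set \<Rightarrow> nat" where
  "vdist_set G x U = Min {vdist G x y | y. y \<in> U}"

definition min_total_dist ::
  "'a pair_pre_digraph \<Rightarrow> 'a pair_pre_digraph set \<Rightarrow> nat" where
  "min_total_dist G Ps = Min {\<Sum>P\<in>Ps. vdist_set G v (pverts P) | v. v \<in> pverts G}"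

end

(* Let f > 0 be the minimal total distance of three longest paths p, q, r with N vertices each.
   A vertex on two of them is at distance at least f from the third, so the three paths have no
   common vertex, and every stretch of a path leading from one of the other two paths to the other
   contains a "link" with at least f - 1 vertices private to that path. A walk leaving a longest
   path at x and avoiding it afterwards is at most as long as either side of x; hence both sides of
   the end of a link have length at least 2f - 1.

   If some link ends at a vertex b of p, and p does not meet q on one side of b, then this side
   continued up to the first vertex c of q has length at least 3f - 1. It leaves q at c, and so
   does the link at its other end, continued by the side of b; thus N >= 7f - 1. If q misses r on
   one side of c, repeating the argument with the link of p ending at c gives even N >= 9f - 1, and
   q, the initial part of p and one link of r have enough vertices. If no such repetition is
   possible, three links can be found on r and on p behind c: 7f - 1 + 3f - 1 + 3 (f - 1) vertices.

   Otherwise each path meets the other two alternately at least four times, so it has three links.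
   By exchange, the two vertices of q around a detour of p through r are at least 2f apart on q,
   and the same with p and r swapped; again N >= 7f - 1, and the six links on p and r, with one
   vertex common to p and r, bring the count to 7f - 1 + 6 (f - 1) + 1 = 13f - 6. *)

theory Submission
  imports Defs
begin

section \<open>Paths as vertex lists, and links between two lists\<close>

definition upath :: "('a \<Rightarrow> 'a \<Rightarrow> bool) \<Rightarrow> 'a list \<Rightarrow> bool" where
  "upath E xs \<longleftrightarrow> distinct xs \<and> successively E xs"

lemma upath_append_iff:
  "upath E (xs @ ys) \<longleftrightarrow> upath E xs \<and> upath E ys \<and> set xs \<inter> set ys = {} \<and>
     (xs = [] \<or> ys = [] \<or> E (last xs) (hd ys))"
  by (auto simp: upath_def successively_append_iff)

lemma upath_join:
  assumes "upath E (l @ [x])" "upath E (x # h)" "set l \<inter> set h = {}"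
  shows "upath E (l @ x # h)"
  using assms by (auto simp: upath_append_iff)

lemma upath_rev:
  assumes "\<And>x y. E x y \<Longrightarrow> E y x" "upath E xs"
  shows "upath E (rev xs)"
proof -
  have "successively (\<lambda>x y. E y x) xs"
    using assms by (auto simp: upath_def intro: successively_mono)
  then show ?thesis using assms by (auto simp: upath_def successively_rev)
qed

lemma split_between:
  assumes "i < j" "j < length p"
  obtains xs ys zs where "p = xs @ p ! i # ys @ p ! j # zs" "length xs = i" "length ys = j - i - 1"
proof
  let ?ys = "take (j - i - 1) (drop (i + 1) p)"
  have 1: "drop (i + 1) p = ?ys @ drop (j - i - 1) (drop (i + 1) p)"
      by (simp only: append_take_drop_id)
  have 2: "drop (j - i - 1) (drop (i + 1) p) = drop j p" using assms by simp
  have 3: "drop j p = p ! j # drop (j + 1) p" using assms by (metis Cons_nth_drop_Suc Suc_eq_plus1)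
  have 4: "p = take i p @ p ! i # drop (i + 1) p"
    using assms by (simp add: id_take_nth_drop)
  show "p = take i p @ p ! i # ?ys @ p ! j # drop (j + 1) p"
    using 1 2 3 4 by metis
  show "length (take i p) = i" using assms by simp
  show "length ?ys = j - i - 1" using assms by simp
qed

text \<open>Nothing ties \<open>m\<close> to the third path; where both ends have to lie on it, this
  is a separate hypothesis. \<open>m\<close> may be empty, so a single edge can be a link.\<close>

definition link :: "('a \<Rightarrow> 'a \<Rightarrow> bool) \<Rightarrow> 'a list \<Rightarrow> 'a list \<Rightarrow> 'a \<Rightarrow> 'a list \<Rightarrow> 'a \<Rightarrow> bool" where
  "link E q r a m b \<longleftrightarrow> upath E (a # m @ [b]) \<and> a \<in> set q \<and> b \<in> set r \<and>
     set m \<inter> (set q \<union> set r) = {}"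

text \<open>Cut at the first vertex of \<open>r\<close>, then go back to the last vertex of
  \<open>q\<close> before it. As no vertex of the list lies on both, \<open>x\<close> is off
  \<open>r\<close>, so the part before the cut still contains a vertex of \<open>q\<close>.\<close>

lemma link_in_list:
  assumes "upath E (x # ys @ [y])" "x \<in> set q" "y \<in> set r"
    "set (x # ys @ [y]) \<inter> set q \<inter> set r = {}"
  obtains u a m b v where "x # ys @ [y] = u @ a # m @ b # v" "link E q r a m b"
proof -
  have "\<exists>z\<in>set (x # ys @ [y]). z \<in> set r" using assms by auto
  then obtain us b v where 1: "x # ys @ [y] = us @ b # v" "b \<in> set r" "\<forall>z\<in>set us. z \<notin> set r"
    by (rule split_list_first_propE) blast
  have "x \<notin> set r" using assms by auto
  then have "us \<noteq> []" using 1 by auto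
  then have "x \<in> set us" using 1(1) by (cases us) auto
  then have "\<exists>z\<in>set us. z \<in> set q" using assms by auto
  then obtain u a m where 2: "us = u @ a # m" "a \<in> set q" "\<forall>z\<in>set m. z \<notin> set q"
    by (rule split_list_last_propE) blast
  have eq: "x # ys @ [y] = u @ (a # m @ [b]) @ v" using 1 2 by simp
  have "upath E (a # m @ [b])" using assms(1) unfolding eq by (simp only: upath_append_iff)
  then have "link E q r a m b" using 1 2 by (auto simp: link_def)
  then show ?thesis using that eq by simp
qed

section \<open>Maximality, hairs and the distance condition\<close>

locale path_bound =
  fixes E :: "'a \<Rightarrow> 'a \<Rightarrow> bool" and N f :: nat
  assumes E_sym: "E x y \<Longrightarrow> E y x"
    and bound: "upath E xs \<Longrightarrow> length xs \<le> N"
    and f_pos: "1 \<le> f"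
begin

abbreviation "path \<equiv> upath E"

lemma path_rev: "path xs \<Longrightarrow> path (rev xs)"
  using upath_rev E_sym by metis

lemma path_sub: "path (xs @ ys @ zs) \<Longrightarrow> path ys"
  by (simp add: upath_append_iff)

lemma link_sym: "link E q r a m b \<Longrightarrow> link E r q b (rev m) a"
  using path_rev[of "a # m @ [b]"] by (auto simp: link_def)

text \<open>Replacing either side of \<open>x\<close> by the hair \<open>h\<close> gives a path
  again, and it has at most \<open>N\<close> vertices.\<close>

lemma hair_le:
  assumes "path p" "length p = N" "p = l @ x # s" "path (x # h)" "set h \<inter> set p = {}"
  shows "length h \<le> length l" "length h \<le> length s"
proof -
  have "path (l @ [x])" using assms(1,3) path_sub[of "[]" "l @ [x]" s] by simp
  then have "path (l @ x # h)" by (rule upath_join) (use assms in auto)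
  from bound[OF this] show "length h \<le> length s" using assms by simp
  have "path (x # s)" using assms(1,3) path_sub[of l "x # s" "[]"] by simp
  then have "path (rev s @ [x])" using path_rev[of "x # s"] by simp
  then have "path (rev s @ x # h)" by (rule upath_join) (use assms in auto)
  from bound[OF this] show "length h \<le> length l" using assms by simp
qed

text \<open>Prepending a link to a path that starts at \<open>b\<close> and avoids \<open>q\<close>
  produces a hair on \<open>q\<close> at \<open>a\<close>, to which \<open>hair_le\<close> applies.
  In this way lengths found on one path are carried over to another.\<close>

lemma link_hair:
  assumes "link E q r a m b" "path (b # h)" "set h \<inter> set q = {}" "set h \<inter> set m = {}"
    "b \<notin> set q" "a \<notin> set r"
  shows "path (a # m @ b # h)" "set (m @ b # h) \<inter> set q = {}"
proof -
  have 1: "path ((a # m) @ [b])" "a \<in> set q" using assms by (auto simp: link_def)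
  have "path ((a # m) @ b # h)" by (rule upath_join[OF 1(1) assms(2)]) (use assms 1 in auto)
  then show "path (a # m @ b # h)" by simp
  show "set (m @ b # h) \<inter> set q = {}" using assms by (auto simp: link_def)
qed

text \<open>At a common vertex of \<open>p\<close> and \<open>q\<close> the total distance is just
  the distance to \<open>r\<close>, hence at least \<open>f\<close>. Since \<open>length\<close>
  counts vertices, \<open>f < length xs\<close> means at least \<open>f\<close> edges.\<close>

definition apart :: "'a list \<Rightarrow> 'a list \<Rightarrow> 'a list \<Rightarrow> bool" where
  "apart p q r \<longleftrightarrow> (\<forall>xs. path xs \<longrightarrow> xs \<noteq> [] \<longrightarrow> hd xs \<in> set p \<inter> set q \<longrightarrow> last xs \<in> set r \<longrightarrow> f < length xs)"

text \<open>Three instances of \<open>apart\<close> cover all six orders, as it is symmetric in its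
  first two arguments. Thus \<open>tri\<close> is invariant under permuting the paths and reversing
  any of them.\<close>

definition tri :: "'a list \<Rightarrow> 'a list \<Rightarrow> 'a list \<Rightarrow> bool" where
  "tri p q r \<longleftrightarrow> path p \<and> path q \<and> path r \<and> length p = N \<and> length q = N \<and> length r = N \<and>
     set p \<inter> set q \<noteq> {} \<and> set q \<inter> set r \<noteq> {} \<and> set p \<inter> set r \<noteq> {} \<and>
     apart p q r \<and> apart q r p \<and> apart p r q"

lemma tri_swap: "tri p q r \<Longrightarrow> tri q p r"
  by (auto simp: tri_def apart_def)

lemma tri_rot: "tri p q r \<Longrightarrow> tri q r p"
  by (auto simp: tri_def apart_def)

lemma tri_rev: "tri p q r \<Longrightarrow> tri (rev p) q r"
  by (auto simp: tri_def apart_def path_rev)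

lemma tri_rev2: "tri p q r \<Longrightarrow> tri p (rev q) r"
  using tri_swap tri_rev by blast

lemma tri_swap23: "tri p q r \<Longrightarrow> tri p r q"
  using tri_swap tri_rot by blast

lemma tri_rev3: "tri p q r \<Longrightarrow> tri p q (rev r)"
  using tri_swap23 tri_rev2 by blast

text \<open>A common vertex would be a path with one vertex, giving \<open>f < 1\<close>.\<close>

lemma tri_disjoint:
  assumes "tri p q r" "x \<in> set p" "x \<in> set q" "x \<in> set r"
  shows False
proof -
  have "path [x]" by (simp add: upath_def)
  then have "f < length [x]" using assms unfolding tri_def apart_def by fastforce
  then show False using f_pos by simp
qed

lemma tri_far:
  assumes "tri p q r" "path (x # ys @ [y])" "x \<in> set p" "x \<in> set q" "y \<in> set r"
  shows "f \<le> length ys + 1"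
proof -
  have "f < length (x # ys @ [y])" using assms unfolding tri_def apart_def by fastforce
  then show ?thesis by simp
qed

lemma segment_length:
  assumes "tri p q r" "p = xs @ x # ys @ y # zs" "x \<in> set q \<and> y \<in> set r \<or> x \<in> set r \<and> y \<in> set q"
  shows "f \<le> length ys + 1"
proof -
  have "path (x # ys @ [y])" using assms path_sub[of xs "x # ys @ [y]" zs] by (auto simp: tri_def)
  moreover have "x \<in> set p" "y \<in> set p" using assms(2) by auto
  ultimately show ?thesis
    using assms(3) tri_far[OF assms(1)] tri_far[OF tri_swap23[OF assms(1)]] by blast
qed

lemma index_dist:
  assumes "tri p q r" "i < N" "j < N" "p ! i \<in> set q" "p ! j \<in> set r"
  shows "i + f \<le> j \<or> j + f \<le> i"
proof -
  have len: "length p = N" using assms by (simp add: tri_def)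
  have ne: "i \<noteq> j" using tri_disjoint[OF assms(1)] assms len by (metis nth_mem)
  consider "i < j" | "j < i" using ne by linarith
  then show ?thesis
  proof cases
    case 1
    then obtain xs ys zs where *: "p = xs @ p ! i # ys @ p ! j # zs" "length ys = j - i - 1"
      using split_between[of i j p] assms len by metis
    have "f \<le> length ys + 1" by (rule segment_length[OF assms(1) *(1)]) (use assms in blast)
    then show ?thesis using *(2) 1 by simp
  next
    case 2
    then obtain xs ys zs where *: "p = xs @ p ! j # ys @ p ! i # zs" "length ys = i - j - 1"
      using split_between[of j i p] assms len by metis
    have "f \<le> length ys + 1" by (rule segment_length[OF assms(1) *(1)]) (use assms in blast)
    then show ?thesis using *(2) 2 by simp
  qed
qed

text \<open>Run through the link from \<open>b\<close> back to \<open>a\<close> and continue along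
  \<open>q\<close> until just before \<open>p\<close> is met. This is a hair on \<open>p\<close> at
  \<open>b\<close> with at least \<open>(f - 1) + 1 + (f - 1)\<close> vertices.\<close>

lemma link_sides:
  assumes T: "tri p q r" and L: "link E q p a m b" "a \<in> set r" "b \<in> set r" and p: "p = l @ b # s"
  shows "2 * f - 1 \<le> length l" "2 * f - 1 \<le> length s"
proof -
  have a: "a \<in> set q" "a \<notin> set p" "b \<in> set p" "b \<notin> set q"
    using L tri_disjoint[OF T] by (auto simp: link_def)
  have fm: "f \<le> length m + 1"
    using tri_far[OF tri_rot[OF T], of a m b] L a by (auto simp: link_def)
  have "\<exists>h. path (a # h) \<and> set h \<subseteq> set q \<and> set h \<inter> set p = {} \<and> f \<le> length h + 1"
  proof -
    \<comment> \<open>\<open>q\<close> meets \<open>p\<close> on at least one side of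
      \<open>a\<close>; reversing \<open>q\<close> if necessary puts this side behind
      \<open>a\<close>.\<close>
    obtain q' v s' where q': "q' = v @ a # s'" "set s' \<inter> set p \<noteq> {}" "tri q' p r" "set q' = set q"
    proof -
      obtain v s' where v: "q = v @ a # s'" using a split_list by metis
      have "set v \<inter> set p \<noteq> {} \<or> set s' \<inter> set p \<noteq> {}"
        using T v a by (auto simp: tri_def)
      then show thesis
      proof
        assume "set s' \<inter> set p \<noteq> {}" then show thesis using that v tri_swap[OF T] by blast
      next
        assume "set v \<inter> set p \<noteq> {}"
        then show thesis using that[of "rev q" "rev s'" "rev v"] v tri_swap[OF tri_rev2[OF T]] by auto
      qed
    qed
    from q'(2) have "\<exists>z\<in>set s'. z \<in> set p" by blast
    then obtain h c z where h: "s' = h @ c # z" "c \<in> set p" "\<forall>x\<in>set h. x \<notin> set p"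
      by (rule split_list_first_propE) blast
    have "f \<le> length h + 1"
      using segment_length[OF q'(3), of v a h c z] q' h L by auto
    moreover have "path (a # h)"
      using q' h path_sub[of v "a # h" "c # z"] by (auto simp: tri_def)
    ultimately show ?thesis using q' h by auto
  qed
  then obtain h where h: "path (a # h)" "set h \<subseteq> set q" "set h \<inter> set p = {}" "f \<le> length h + 1" by blast
  have mh: "set h \<inter> set (rev m) = {}" using h L by (auto simp: link_def)
  note H = link_hair[OF link_sym[OF L(1)] h(1) h(3) mh a(2) a(4)]
  have "path p" "length p = N" using T by (auto simp: tri_def)
  from hair_le[OF this p H] fm h f_pos
  show "2 * f - 1 \<le> length l" "2 * f - 1 \<le> length s" by auto
qed

section \<open>Links ending at an outer part of a path\<close>

text \<open>Otherwise the link continued by \<open>l\<close> is a hair on \<open>q\<close> at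
  \<open>a\<close>, and continued by \<open>l'\<close> it is a hair on \<open>p\<close> at
  \<open>b\<close>. By \<open>hair_le\<close>, each of \<open>l\<close> and \<open>l'\<close> would
  be longer than the other.\<close>

lemma link_not_both_outer:
  assumes T: "tri p q r" and L: "link E q p a m b" "a \<in> set r" "b \<in> set r"
    and p: "p = l @ b # s" "set l \<inter> set q = {}" and q: "q = l' @ a # s'" "set l' \<inter> set p = {}"
  shows False
proof -
  have a: "a \<in> set q" "a \<notin> set p" "b \<in> set p" "b \<notin> set q"
    using L tri_disjoint[OF T] by (auto simp: link_def)
  have pp: "path p" "length p = N" "path q" "length q = N" using T by (auto simp: tri_def)
  have "path (l @ [b])" "path (l' @ [a])"
    using pp p q path_sub[of "[]" "l @ [b]" s] path_sub[of "[]" "l' @ [a]" s'] by auto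
  then have h: "path (b # rev l)" "path (a # rev l')"
    using path_rev[of "l @ [b]"] path_rev[of "l' @ [a]"] by auto
  have "length (m @ b # rev l) \<le> length l'"
    by (rule hair_le[OF pp(3,4) q(1)], (rule link_hair[OF L(1) h(1)]; use p q a L in \<open>auto simp: link_def\<close>)+)
  moreover have "length (rev m @ a # rev l') \<le> length l"
    by (rule hair_le[OF pp(1,2) p(1)], (rule link_hair[OF link_sym[OF L(1)] h(2)]; use p q a L in \<open>auto simp: link_def\<close>)+)
  ultimately show False by simp
qed

text \<open>On \<open>q\<close> there are hairs at \<open>c\<close> (back along \<open>l2\<close>,
  \<open>b\<close> and \<open>l\<close>) and at \<open>a\<close> (the link, then back along
  \<open>l\<close>), each with at least \<open>length l + f\<close> vertices. Since \<open>a\<close>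
  and \<open>c\<close> are at least \<open>f\<close> apart on \<open>q\<close>, twice this number
  plus \<open>f + 1\<close> is at most \<open>N\<close>.\<close>

lemma outer_link:
  assumes T: "tri p q r" and L: "link E q p a m b" "a \<in> set r" "b \<in> set r"
    and p: "p = l @ b # l2 @ c # r1" "set l \<inter> set q = {}" "set l2 \<inter> set q = {}" "c \<in> set q"
  shows "f \<le> length l2 + 1" "2 * length l + 3 * f + 1 \<le> N"
    "\<And>l' s'. q = l' @ c # s' \<Longrightarrow> length l + f \<le> length l' \<and> length l + f \<le> length s'"
proof -
  have a: "a \<in> set q" "a \<notin> set p" "b \<in> set p" "b \<notin> set q"
    using L tri_disjoint[OF T] by (auto simp: link_def)
  have pp: "path p" "length p = N" "path q" "length q = N" using T by (auto simp: tri_def)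
  show l2: "f \<le> length l2 + 1" using segment_length[OF T p(1)] p L by auto
  have fm: "f \<le> length m + 1"
    using tri_far[OF tri_rot[OF T], of a m b] L a by (auto simp: link_def)
  have "path (l @ [b])" "path (l @ b # l2 @ [c])"
    using pp p path_sub[of "[]" "l @ [b]" "l2 @ c # r1"] path_sub[of "[]" "l @ b # l2 @ [c]" "r1"] by auto
  then have h: "path (b # rev l)" "path (c # rev (l @ b # l2))"
    using path_rev[of "l @ [b]"] path_rev[of "l @ b # l2 @ [c]"] by auto
  have sc: "length l + f \<le> length l' \<and> length l + f \<le> length s'" if "q = l' @ c # s'" for l' s'
  proof -
    have "set (rev (l @ b # l2)) \<inter> set q = {}" using p(2,3) a by auto
    from hair_le[OF pp(3,4) that h(2) this] show ?thesis using l2 by simp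
  qed
  then show "\<And>l' s'. q = l' @ c # s' \<Longrightarrow> length l + f \<le> length l' \<and> length l + f \<le> length s'" by blast
  have H: "path (a # m @ b # rev l)" "set (m @ b # rev l) \<inter> set q = {}"
    by (rule link_hair[OF L(1) h(1)]; use p a L in \<open>auto simp: link_def\<close>)+
  have sa: "length l + f \<le> length l' \<and> length l + f \<le> length s'" if "q = l' @ a # s'" for l' s'
    using hair_le[OF pp(3,4) that H] fm by auto
  have "c \<in> set p" using p by simp
  obtain u w where uw: "q = u @ a # w" using a split_list by metis
  have "c \<in> set u \<or> c \<in> set w" using uw p a \<open>c \<in> set p\<close> by auto
  then show "2 * length l + 3 * f + 1 \<le> N"
  proof
    assume "c \<in> set u"
    then obtain u1 u2 where "u = u1 @ c # u2" using split_list by metis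
    then have q: "q = u1 @ c # u2 @ a # w" using uw by simp
    have "f \<le> length u2 + 1" using segment_length[OF tri_swap[OF T] q] L \<open>c \<in> set p\<close> by auto
    moreover have "length l + f \<le> length u1" using sc q by auto
    moreover have "length l + f \<le> length w" using sa uw by auto
    ultimately show ?thesis using pp(4) q by simp
  next
    assume "c \<in> set w"
    then obtain u1 u2 where "w = u1 @ c # u2" using split_list by metis
    then have q: "q = u @ a # u1 @ c # u2" using uw by simp
    have "f \<le> length u1 + 1" using segment_length[OF tri_swap[OF T] q] L \<open>c \<in> set p\<close> by auto
    moreover have "length l + f \<le> length u2" using sc[of "u @ a # u1" u2] q by auto
    moreover have "length l + f \<le> length u" using sa uw by auto
    ultimately show ?thesis using pp(4) q by simp
  qed
qed

section \<open>Links on segments and the private vertices they contribute\<close>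

lemma link_on_segment:
  assumes T: "tri p q r" and r: "r = xs @ x # ys @ y # zs" and xy: "x \<in> set q" "y \<in> set p"
  obtains u a m b v where "x # ys @ [y] = u @ a # m @ b # v" "link E q p a m b" "set (x # ys @ [y]) \<subseteq> set r"
proof -
  have "path (x # ys @ [y])" using T r path_sub[of xs "x # ys @ [y]" zs] by (auto simp: tri_def)
  moreover have sub: "set (x # ys @ [y]) \<subseteq> set r" using r by auto
  then have "set (x # ys @ [y]) \<inter> set q \<inter> set p = {}" using tri_disjoint[OF T] by blast
  ultimately obtain u a m b v where "x # ys @ [y] = u @ a # m @ b # v" "link E q p a m b"
    using link_in_list xy by metis
  then show ?thesis using that sub by blast
qed

lemma ex_link:
  assumes T: "tri p q r"
  obtains a m b where "link E q p a m b" "a \<in> set r" "b \<in> set r"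
proof -
  obtain x y where xy: "x \<in> set r" "x \<in> set q" "y \<in> set r" "y \<in> set p"
    using T unfolding tri_def by blast
  then have "x \<noteq> y" using tri_disjoint[OF T] by blast
  obtain l s where ls: "r = l @ x # s" using xy split_list by metis
  then have "y \<in> set s \<or> y \<in> set l" using xy \<open>x \<noteq> y\<close> by auto
  then obtain r' xs ys zs where r': "tri p q r'" "set r' = set r" "r' = xs @ x # ys @ y # zs"
  proof
    assume "y \<in> set s"
    then obtain s1 s2 where "s = s1 @ y # s2" using split_list by metis
    then show thesis using that[of r] T ls by blast
  next
    assume "y \<in> set l"
    then obtain s1 s2 where "l = s1 @ y # s2" using split_list by metis
    then show thesis using that[of "rev r" "rev s" "rev s2" "rev s1"] tri_rev3[OF T] ls by auto
  qed
  from link_on_segment[OF r'(1,3) xy(2,4)]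
  obtain u a m b v where *: "x # ys @ [y] = u @ a # m @ b # v" "link E q p a m b"
    "set (x # ys @ [y]) \<subseteq> set r'" by metis
  then have "set (u @ a # m @ b # v) \<subseteq> set r" using r'(2) by metis
  then show ?thesis using that * by auto
qed

text \<open>The segment contains a link. Its interior lies on \<open>p\<close> and avoids
  \<open>q\<close> and \<open>r\<close>, and it has at least \<open>f - 1\<close> vertices because
  an end of the link is common to \<open>p\<close> and one of the other paths, while the opposite
  end lies on the third.\<close>

lemma segment_private:
  assumes T: "tri p q r" and p: "p = xs @ x # ys @ y # zs"
    and xy: "x \<in> set q \<and> y \<in> set r \<or> x \<in> set r \<and> y \<in> set q"
  shows "f - 1 \<le> card (set ys - set q - set r)"
proof -
  have main: "f - 1 \<le> card (set ys - set q - set r)"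
    if T: "tri r q p" and xy: "x \<in> set q" "y \<in> set r" for q r
  proof -
    from link_on_segment[OF T p xy]
    obtain u a m b v where *: "x # ys @ [y] = u @ a # m @ b # v" "link E q r a m b"
      "set (x # ys @ [y]) \<subseteq> set p" by metis
    have "set (u @ a # m @ b # v) \<subseteq> set p" using * by metis
    then have "f \<le> length m + 1"
      using tri_far[OF tri_rot[OF tri_rot[OF tri_swap[OF T]]], of a m b] *(2)
        tri_far[OF tri_rot[OF T], of a m b] by (auto simp: link_def)
    moreover have "distinct m" using *(2) by (auto simp: link_def upath_def)
    \<comment> \<open>\<open>m\<close> touches neither the first nor the last position of the
      segment, and these are the only ones missing from \<open>ys\<close>.\<close>
    moreover have "set m \<subseteq> set ys"
    proof -
      have "set m \<subseteq> set (tl (butlast (u @ a # m @ b # v)))"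
        by (cases u; cases v rule: rev_cases) (auto simp: butlast_append)
      also have "tl (butlast (u @ a # m @ b # v)) = ys"
        unfolding *(1)[symmetric] by simp
      finally show ?thesis .
    qed
    moreover have "set m \<inter> (set q \<union> set r) = {}" using *(2) by (simp add: link_def)
    ultimately have "set m \<subseteq> set ys - set q - set r" "f - 1 \<le> card (set m)"
      by (auto simp: distinct_card)
    then show ?thesis by (meson card_mono finite_Diff finite_set le_trans)
  qed
  show ?thesis
    using xy main[of r q] main[of q r] tri_rot[OF T] tri_swap[OF tri_rot[OF T]]
    by (metis Diff_insert Diff_Un Un_commute Diff_eq Int_assoc Int_commute)
qed

lemma private_two:
  assumes T: "tri p q r" and p: "p = xs @ x # ys @ y # ys' @ z # zs"
    and xyz: "x \<in> set q \<and> y \<in> set r \<and> z \<in> set q \<or> x \<in> set r \<and> y \<in> set q \<and> z \<in> set r"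
  shows "2 * (f - 1) \<le> card (set (ys @ ys') - set q - set r)"
proof -
  have "f - 1 \<le> card (set ys - set q - set r)"
    using segment_private[OF T, of xs x ys y "ys' @ z # zs"] p xyz by auto
  moreover have "f - 1 \<le> card (set ys' - set q - set r)"
    using segment_private[OF T, of "xs @ x # ys" y ys' z zs] p xyz by auto
  moreover have "card (set (ys @ ys') - set q - set r) =
    card (set ys - set q - set r) + card (set ys' - set q - set r)"
  proof -
    have "distinct p" using T by (simp add: tri_def upath_def)
    then have "(set ys - set q - set r) \<inter> (set ys' - set q - set r) = {}" using p by auto
    moreover have "set (ys @ ys') - set q - set r = (set ys - set q - set r) \<union> (set ys' - set q - set r)" by auto
    ultimately show ?thesis by (simp add: card_Un_disjoint)
  qed
  ultimately show ?thesis by simp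
qed

text \<open>The gaps \<open>B\<close>, \<open>C\<close> and \<open>D\<close> may contain further
  vertices of \<open>q\<close> and \<open>r\<close>, so this means at least four alternating
  meetings, the first of them with \<open>q\<close>.\<close>

definition alt4 :: "'a list \<Rightarrow> 'a list \<Rightarrow> 'a list \<Rightarrow> bool" where
  "alt4 p q r \<longleftrightarrow> (\<exists>A x B y C z D w F. p = A @ x # B @ y # C @ z # D @ w # F \<and>
     x \<in> set q \<and> y \<in> set r \<and> z \<in> set q \<and> w \<in> set r)"

lemma private_alt4:
  assumes T: "tri p q r" and A: "alt4 p q r \<or> alt4 p r q"
  shows "3 * (f - 1) \<le> card (set p - set q - set r)"
proof -
  have main: "3 * (f - 1) \<le> card (set p - set q - set r)" if T: "tri p q r" and "alt4 p q r" for q r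
  proof -
    from \<open>alt4 p q r\<close> obtain A x B y C z D w F where p: "p = A @ x # B @ y # C @ z # D @ w # F"
      and x: "x \<in> set q" "y \<in> set r" "z \<in> set q" "w \<in> set r" unfolding alt4_def by blast
    have "2 * (f - 1) \<le> card (set (B @ C) - set q - set r)"
      using private_two[OF T, of A x B y C z "D @ w # F"] p x by auto
    moreover have "f - 1 \<le> card (set D - set q - set r)"
      using segment_private[OF T, of "A @ x # B @ y # C" z D w F] p x by auto
    moreover have "card (set (B @ C) - set q - set r) + card (set D - set q - set r) \<le> card (set p - set q - set r)"
    proof -
      have "distinct p" using T by (simp add: tri_def upath_def)
      then have "(set (B @ C) - set q - set r) \<inter> (set D - set q - set r) = {}" using p by auto
      then have "card (set (B @ C) - set q - set r) + card (set D - set q - set r) =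
        card ((set (B @ C) - set q - set r) \<union> (set D - set q - set r))"
        by (simp add: card_Un_disjoint)
      also have "\<dots> \<le> card (set p - set q - set r)" by (rule card_mono) (auto simp: p)
      finally show ?thesis .
    qed
    ultimately show ?thesis by simp
  qed
  show ?thesis using A main[OF T] main[OF tri_swap23[OF T]]
    by (auto simp: Diff_eq Int_ac)
qed

text \<open>Whichever of \<open>x\<close> and \<open>y\<close> comes first on \<open>p\<close>, add
  a vertex in front of it and one behind the other. The order is \<open>q\<close>, \<open>r\<close>,
  \<open>q\<close>, \<open>r\<close> if \<open>x\<close> comes first and \<open>r\<close>,
  \<open>q\<close>, \<open>r\<close>, \<open>q\<close> if \<open>y\<close> does.\<close>

lemma alt4I:
  assumes T: "tri p q r"
    and x: "p = l @ x # s" "x \<in> set r" "set l \<inter> set q \<noteq> {}" "set s \<inter> set q \<noteq> {}"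
    and y: "p = l' @ y # s'" "y \<in> set q" "set l' \<inter> set r \<noteq> {}" "set s' \<inter> set r \<noteq> {}"
  shows "alt4 p q r \<or> alt4 p r q"
proof -
  have d: "distinct p" using T by (simp add: tri_def upath_def)
  have "x \<noteq> y" using tri_disjoint[OF T, of x] x y by auto
  then have "y \<in> set l \<or> y \<in> set s" using x(1) y(1) by (metis UnE in_set_conv_decomp set_ConsD set_append)
  then show ?thesis
  proof
    assume "y \<in> set s"
    then obtain s1 s2 where s: "s = s1 @ y # s2" using split_list by metis
    have "s' = s2" using d x(1) y(1) s append_Cons_eq_iff[of y "l @ x # s1" s2 l' s'] by auto
    then obtain w where w: "w \<in> set s2" "w \<in> set r" using y by auto
    obtain v where v: "v \<in> set l" "v \<in> set q" using x by auto
    obtain l1 l2 e1 e2 where "l = l1 @ v # l2" "s2 = e1 @ w # e2"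
      using v w split_list by metis
    then have "p = l1 @ v # l2 @ x # s1 @ y # e1 @ w # e2" using x s by simp
    then show ?thesis using v w x y unfolding alt4_def by blast
  next
    assume "y \<in> set l"
    then obtain l1 l2 where l: "l = l1 @ y # l2" using split_list by metis
    have "l' = l1" using d x(1) y(1) l append_Cons_eq_iff[of y l1 "l2 @ x # s" l' s'] by auto
    then obtain w where w: "w \<in> set l1" "w \<in> set r" using y by auto
    obtain v where v: "v \<in> set s" "v \<in> set q" using x by auto
    obtain s1 s2 e1 e2 where "s = s1 @ v # s2" "l1 = e1 @ w # e2"
      using v w split_list by metis
    then have "p = e1 @ w # e2 @ y # l2 @ x # s1 @ v # s2" using x l by simp
    then show ?thesis using v w x y unfolding alt4_def by blast
  qed
qed

text \<open>The sets counted are disjoint: \<open>q\<close>, the part \<open>t\<close> of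
  \<open>p\<close> off \<open>q\<close>, and the private vertices of \<open>s\<close> and of
  \<open>r\<close>.\<close>

lemma card_union_ge:
  assumes T: "tri p q r" and p: "p = t @ s" "set t \<inter> set q = {}"
  shows "N + length t + card (set s - set q - set r) + card (set r - set p - set q) \<le>
    card (set p \<union> set q \<union> set r)"
proof -
  have d: "distinct p" "distinct q" "length q = N" using T by (auto simp: tri_def upath_def)
  have "N + length t + card (set s - set q - set r) + card (set r - set p - set q) =
    card (set q) + card (set t) + card (set s - set q - set r) + card (set r - set p - set q)"
    using d p by (simp add: distinct_card)
  also have "\<dots> = card (set q \<union> set t \<union> (set s - set q - set r) \<union> (set r - set p - set q))"
    using d p by (subst card_Un_disjoint | auto)+
  also have "\<dots> \<le> card (set p \<union> set q \<union> set r)" by (rule card_mono) (use p in auto)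
  finally show ?thesis .
qed

lemma private_one:
  assumes T: "tri p q r"
  shows "f - 1 \<le> card (set p - set q - set r)"
proof -
  obtain x y where xy: "x \<in> set p" "x \<in> set q" "y \<in> set p" "y \<in> set r"
    using T unfolding tri_def by blast
  then have "x \<noteq> y" using tri_disjoint[OF T] by blast
  obtain l s where ls: "p = l @ x # s" using xy split_list by metis
  then have "y \<in> set s \<or> y \<in> set l" using xy \<open>x \<noteq> y\<close> by auto
  then obtain ys where "f - 1 \<le> card (set ys - set q - set r)" "set ys \<subseteq> set p"
  proof
    assume "y \<in> set s"
    then obtain s1 s2 where "s = s1 @ y # s2" using split_list by metis
    then show thesis using that[of s1] segment_private[OF T, of l x s1 y s2] ls xy by auto
  next
    assume "y \<in> set l"
    then obtain s1 s2 where "l = s1 @ y # s2" using split_list by metis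
    then show thesis using that[of s2] segment_private[OF T, of s1 y s2 x s] ls xy by auto
  qed
  moreover have "card (set ys - set q - set r) \<le> card (set p - set q - set r)"
    using calculation by (intro card_mono) auto
  ultimately show ?thesis by linarith
qed

section \<open>The bound when some link has an outer end\<close>

text \<open>The piece of \<open>p\<close> from its last vertex of \<open>r\<close> before
  \<open>c\<close> up to \<open>c\<close> is a link from \<open>r\<close> to \<open>q\<close>, and
  the side \<open>l'\<close> of \<open>c\<close> on \<open>q\<close> misses \<open>r\<close>. So
  \<open>outer_link\<close> applies once more, with \<open>l'\<close> in the role of
  \<open>l\<close>. As \<open>length l' \<ge> length l + f \<ge> 3 * f - 1\<close>, it yields
  \<open>N \<ge> 9 * f - 1\<close>.\<close>

lemma two_outer_links_card:
  assumes T: "tri p q r" and L: "link E q p a m b" "a \<in> set r" "b \<in> set r"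
    and p: "p = l @ b # l2 @ c # r1" "set l \<inter> set q = {}" "set l2 \<inter> set q = {}" "c \<in> set q"
    and q: "q = l' @ c # s'" "set l' \<inter> set r = {}"
  shows "13 * f \<le> card (set p \<union> set q \<union> set r) + 6"
proof -
  note O = outer_link[OF T L p]
  have l: "2 * f - 1 \<le> length l" using link_sides[OF T L p(1)] by simp
  have cp: "c \<in> set p" "c \<notin> set r" using p tri_disjoint[OF T, of c] by auto
  have "\<exists>z\<in>set (l @ b # l2). z \<in> set r" using L by simp
  then obtain t b' m' where t: "l @ b # l2 = t @ b' # m'" "b' \<in> set r" "\<forall>z\<in>set m'. z \<notin> set r"
    by (rule split_list_last_propE) blast
  have p': "p = t @ (b' # m' @ [c]) @ r1" using p(1) t(1) by simp
  have "path (b' # m' @ [c])" using T p' path_sub[of t "b' # m' @ [c]" r1] by (auto simp: tri_def)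
  moreover have "set m' \<subseteq> set (l @ b # l2)" unfolding t(1) by auto
  then have "set m' \<inter> set q = {}" using p L tri_disjoint[OF T, of b] by (auto simp: link_def)
  ultimately have L': "link E r q b' m' c" using t p by (auto simp: link_def)
  have "\<exists>z\<in>set s'. z \<in> set r" using T q cp by (auto simp: tri_def)
  then obtain l3 a' r3 where s': "s' = l3 @ a' # r3" "a' \<in> set r" "\<forall>z\<in>set l3. z \<notin> set r"
    by (rule split_list_first_propE) blast
  have "2 * length l' + 3 * f + 1 \<le> N"
    by (rule outer_link(2)[OF tri_rot[OF T] L', where ?l2.0 = l3 and c = a' and ?r1.0 = r3])
      (use p' cp q s' in auto)
  moreover have "length l + f \<le> length l'" using O(3)[OF q(1)] by simp
  moreover have "N + length (l @ b # l2) + card (set (c # r1) - set q - set r) + card (set r - set p - set q)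
      \<le> card (set p \<union> set q \<union> set r)"
    by (rule card_union_ge[OF T]) (use p L tri_disjoint[OF T, of b] in \<open>auto simp: link_def\<close>)
  moreover have "f - 1 \<le> card (set r - set p - set q)"
    using private_one[OF tri_rot[OF tri_rot[OF T]]] .
  \<comment> \<open>The count is at least
    \<open>(9 * f - 1) + (3 * f - 1) + (f - 1)\<close>.\<close>
  ultimately show ?thesis using l O(1) f_pos by simp
qed

lemma two_outer_links_card':
  assumes T: "tri p q r" and L: "link E q p a m b" "a \<in> set r" "b \<in> set r"
    and p: "p = l @ b # l2 @ c # r1" "set l \<inter> set q = {}" "set l2 \<inter> set q = {}" "c \<in> set q"
    and q: "q = l' @ c # s'" "set l' \<inter> set r = {} \<or> set s' \<inter> set r = {}"
  shows "13 * f \<le> card (set p \<union> set q \<union> set r) + 6"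
  using q(2)
proof
  assume "set l' \<inter> set r = {}" then show ?thesis using two_outer_links_card[OF T L p q(1)] by simp
next
  assume s: "set s' \<inter> set r = {}"
  have "13 * f \<le> card (set p \<union> set (rev q) \<union> set r) + 6"
    by (rule two_outer_links_card[OF tri_rev2[OF T] _ L(2,3) p(1), where l' = "rev s'" and s' = "rev l'" and m = m])
      (use L p q s in \<open>auto simp: link_def\<close>)
  then show ?thesis by simp
qed

lemma link_rev_right: "link E q (rev p) a m b \<longleftrightarrow> link E q p a m b"
  by (simp add: link_def)

lemma link_rev_left: "link E (rev q) p a m b \<longleftrightarrow> link E q p a m b"
  by (simp add: link_def)

text \<open>A link on \<open>q\<close> from \<open>r\<close> to \<open>p\<close> ends at
  \<open>c\<close> or behind it, so it is outer on the reversed \<open>p\<close>. On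
  \<open>r\<close>, its end \<open>a\<close> has \<open>p\<close> on both sides by
  \<open>link_not_both_outer\<close>. The first vertex \<open>b\<close> of \<open>r\<close> on the
  reversed \<open>p\<close> has \<open>q\<close> on both sides along \<open>r\<close>, since
  otherwise \<open>two_outer_links_card'\<close> gives the bound. Hence \<open>r\<close> alternates
  and has three links.\<close>

lemma outer_private_if_apart:
  assumes T: "tri p q r"
    and p: "p = t @ c # r1" "set t \<inter> set q = {}" "set t \<inter> set r \<noteq> {}" "c \<in> set q"
    and r1: "set r1 \<inter> set r = {}"
    and small: "\<not> 13 * f \<le> card (set p \<union> set q \<union> set r) + 6"
  shows "3 * (f - 1) \<le> card (set r - set p - set q)"
proof -
  obtain a m c' where L: "link E r p a m c'" "a \<in> set q" "c' \<in> set q"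
    using ex_link[OF tri_swap23[OF T]] by metis
  have c': "c' \<in> set p" "a \<in> set r" using L by (auto simp: link_def)
  then have "c' \<in> set (c # r1)" using p L by auto
  then obtain v w where vw: "c # r1 = v @ c' # w" using split_list by metis
  then have w: "set w \<subseteq> set r1" by (cases v) auto
  have "\<exists>z\<in>set (t @ v). z \<in> set r" using p(3) by auto
  then obtain t' b l2 where t': "t @ v = t' @ b # l2" "b \<in> set r" "\<forall>z\<in>set l2. z \<notin> set r"
    by (rule split_list_last_propE) blast
  have p': "p = (t' @ b # l2) @ c' # w" using p(1) vw t'(1) by simp
  have rp: "rev p = rev w @ c' # rev l2 @ b # rev t'" using p' by simp
  have T': "tri (rev p) r q" using tri_rev[OF tri_swap23[OF T]] .
  have L': "link E r (rev p) a m c'" using L by (simp add: link_rev_right)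
  obtain l' s' where r: "r = l' @ b # s'" using t' split_list by metis
  have "\<not> (set l' \<inter> set q = {} \<or> set s' \<inter> set q = {})"
  proof
    assume "set l' \<inter> set q = {} \<or> set s' \<inter> set q = {}"
    then have "13 * f \<le> card (set (rev p) \<union> set r \<union> set q) + 6"
      by (intro two_outer_links_card'[OF T' L' L(2,3) rp _ _ _ r]) (use r1 w t' in auto)
    then show False using small by (simp add: Un_ac)
  qed
  moreover obtain u s where us: "r = u @ a # s" using c' split_list by metis
  have "set u \<inter> set p \<noteq> {}"
    using link_not_both_outer[OF T' L' L(2,3) rp _ us] r1 w by auto
  moreover have "set s \<inter> set p \<noteq> {}"
  proof
    assume s: "set s \<inter> set p = {}"
    have L'': "link E (rev r) (rev p) a m c'" using L' by (simp add: link_rev_left)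
    have "rev r = rev s @ a # rev u" using us by simp
    from link_not_both_outer[OF tri_rev2[OF T'] L'' L(2,3) rp _ this] show False using s r1 w by auto
  qed
  ultimately have "alt4 r q p \<or> alt4 r p q"
    by (intro alt4I[OF tri_swap[OF tri_rot[OF T]] r _ _ _ us]) (use p' L in auto)
  then show ?thesis using private_alt4[OF tri_rot[OF tri_rot[OF T]]] by blast
qed

text \<open>Behind \<open>c\<close>, \<open>p\<close> returns to \<open>r\<close>, which is one
  link. Let \<open>a\<close> be the end on \<open>r\<close> of a link on \<open>q\<close>. If
  \<open>r\<close> meets \<open>p\<close> on both sides of \<open>a\<close>, then \<open>r\<close>
  has two links. Otherwise the link is outer on \<open>r\<close>, so the next vertex
  \<open>b\<close> of \<open>p\<close> on \<open>r\<close> must have \<open>q\<close> on both sides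
  along \<open>p\<close>. Then \<open>b\<close> lies behind \<open>c\<close>, and \<open>p\<close>
  has two links there, while \<open>r\<close> has one.\<close>

lemma outer_private_if_meet:
  assumes T: "tri p q r"
    and p: "p = t @ c # r1" "set t \<inter> set q = {}" "c \<in> set q"
    and r1: "set r1 \<inter> set r \<noteq> {}"
    and small: "\<not> 13 * f \<le> card (set p \<union> set q \<union> set r) + 6"
  shows "3 * (f - 1) \<le> card (set (c # r1) - set q - set r) + card (set r - set p - set q)"
proof -
  have T': "tri r p q" using tri_rot[OF tri_rot[OF T]] .
  obtain c' m a where L: "link E p r c' m a" "c' \<in> set q" "a \<in> set q"
    using ex_link[OF T'] by metis
  have a: "a \<in> set r" "a \<notin> set p" using L tri_disjoint[OF T, of a] by (auto simp: link_def)
  have sub1: "f - 1 \<le> card (set (c # r1) - set q - set r)"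
  proof -
    obtain z s1 s2 where z: "r1 = s1 @ z # s2" "z \<in> set r" using r1 split_list by (metis disjoint_iff)
    have "f - 1 \<le> card (set s1 - set q - set r)"
      using segment_private[OF T, of t c s1 z s2] p z by auto
    also have "\<dots> \<le> card (set (c # r1) - set q - set r)" by (rule card_mono) (auto simp: z)
    finally show ?thesis .
  qed
  obtain u s where us: "r = u @ a # s" using a split_list by metis
  show ?thesis
  proof (cases "set u \<inter> set p \<noteq> {} \<and> set s \<inter> set p \<noteq> {}")
    case True
    then obtain x y u1 u2 s1 s2 where "x \<in> set p" "y \<in> set p" "u = u1 @ x # u2" "s = s1 @ y # s2"
      by (metis disjoint_iff split_list)
    then have "2 * (f - 1) \<le> card (set (u2 @ s1) - set p - set q)"
      using private_two[OF T', of u1 x u2 a s1 y s2] us L by auto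
    also have "\<dots> \<le> card (set r - set p - set q)"
      by (rule card_mono) (use us \<open>u = u1 @ x # u2\<close> \<open>s = s1 @ y # s2\<close> in auto)
    finally show ?thesis using sub1 by simp
  next
    case False
    \<comment> \<open>Orient \<open>r\<close> so that the side of \<open>a\<close> missing
      \<open>p\<close> comes first.\<close>
    then obtain r' u s where r': "tri r' p q" "set r' = set r" "r' = u @ a # s" "set u \<inter> set p = {}"
    proof (cases "set u \<inter> set p = {}")
      case True then show thesis using that[of r] T' us by blast
    next
      case nu: False
      then have "set s \<inter> set p = {}" using False by blast
      then show thesis using that[of "rev r" "rev s" "rev u"] tri_rev[OF T'] us by auto
    qed
    have "\<exists>z\<in>set s. z \<in> set p" using r' a by (auto simp: tri_def)
    then obtain l2 b w where s: "s = l2 @ b # w" "b \<in> set p" "\<forall>z\<in>set l2. z \<notin> set p"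
      by (rule split_list_first_propE) blast
    have L': "link E p r' c' m a" using L r' by (simp add: link_def)
    have r'': "r' = u @ a # l2 @ b # w" using r' s by simp
    have inner: "set v \<inter> set q \<noteq> {} \<and> set v' \<inter> set q \<noteq> {}" if "p = v @ b # v'" for v v'
    proof (rule ccontr)
      assume "\<not> ?thesis"
      then have "13 * f \<le> card (set r' \<union> set p \<union> set q) + 6"
        by (intro two_outer_links_card'[OF r'(1) L' L(2,3) r'' _ _ _ that]) (use r' s in auto)
      then show False using small r'(2) by (simp add: Un_ac)
    qed
    have br: "b \<in> set r" using r'' r'(2) by auto
    have "b \<notin> set t"
    proof
      assume "b \<in> set t"
      then obtain v v' where "t = v @ b # v'" using split_list by metis
      then show False using inner[of v "v' @ c # r1"] p by auto
    qed
    moreover have "b \<noteq> c" using br s p tri_disjoint[OF T, of b] by auto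
    ultimately have "b \<in> set r1" using s p by auto
    then obtain v v' where v: "r1 = v @ b # v'" using split_list by metis
    then have "set v' \<inter> set q \<noteq> {}" using inner[of "t @ c # v" v'] p by auto
    then obtain d d1 d2 where d: "v' = d1 @ d # d2" "d \<in> set q" by (metis disjoint_iff split_list)
    have "2 * (f - 1) \<le> card (set (v @ d1) - set q - set r)"
      using private_two[OF T, of t c v b d1 d d2] p v d br by auto
    also have "\<dots> \<le> card (set (c # r1) - set q - set r)"
      by (rule card_mono) (auto simp: v d)
    finally show ?thesis using private_one[OF T'] by simp
  qed
qed

lemma outer_link_card:
  assumes T: "tri p q r" and L: "link E q p a m b" "a \<in> set r" "b \<in> set r"
    and p: "p = l @ b # s" "set l \<inter> set q = {}"
  shows "13 * f \<le> card (set p \<union> set q \<union> set r) + 6"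
proof (rule ccontr)
  assume small: "\<not> ?thesis"
  have b: "b \<notin> set q" "b \<in> set p" using L tri_disjoint[OF T, of b] by (auto simp: link_def)
  have "\<exists>z\<in>set s. z \<in> set q" using T p b by (auto simp: tri_def)
  then obtain l2 c r1 where s: "s = l2 @ c # r1" "c \<in> set q" "\<forall>z\<in>set l2. z \<notin> set q"
    by (rule split_list_first_propE) blast
  have p': "p = l @ b # l2 @ c # r1" "set l2 \<inter> set q = {}" using p s by auto
  note O = outer_link[OF T L p'(1) p(2) p'(2) s(2)]
  have l: "2 * f - 1 \<le> length l" using link_sides[OF T L p(1)] by simp
  let ?t = "l @ b # l2"
  have t: "p = ?t @ c # r1" "set ?t \<inter> set q = {}" "set ?t \<inter> set r \<noteq> {}" using p p' b L by auto
  have "3 * (f - 1) \<le> card (set (c # r1) - set q - set r) + card (set r - set p - set q)"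
    using outer_private_if_apart[OF T t s(2) _ small] outer_private_if_meet[OF T t(1,2) s(2) _ small]
    by (cases "set r1 \<inter> set r = {}") auto
  moreover have "N + length ?t + card (set (c # r1) - set q - set r) + card (set r - set p - set q)
      \<le> card (set p \<union> set q \<union> set r)"
    by (rule card_union_ge[OF T t(1,2)])
  \<comment> \<open>The count is at least
    \<open>(7 * f - 1) + (3 * f - 1) + 3 * (f - 1)\<close>.\<close>
  ultimately show False using small O(1,2) l f_pos by simp
qed

section \<open>The bound when all three paths alternate\<close>

text \<open>If the bound fails, \<open>outer_link_card\<close> excludes outer ends of links. So on
  \<open>p\<close> the end of a link on \<open>r\<close> has \<open>q\<close> on both sides, and the
  end of a link on \<open>q\<close> has \<open>r\<close> on both sides.\<close>

lemma small_alt4: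
  assumes T: "tri p q r" and small: "\<not> 13 * f \<le> card (set p \<union> set q \<union> set r) + 6"
  shows "alt4 p q r \<or> alt4 p r q"
proof -
  have inner: "set l \<inter> set q \<noteq> {} \<and> set s \<inter> set q \<noteq> {}"
    if T: "tri p q r" and L: "link E q p a m b" "a \<in> set r" "b \<in> set r" and p: "p = l @ b # s"
      and small: "\<not> 13 * f \<le> card (set p \<union> set q \<union> set r) + 6" for q r a m b l s
  proof -
    have "set l \<inter> set q \<noteq> {}" using outer_link_card[OF T L p] small by blast
    moreover have "set s \<inter> set q \<noteq> {}"
    proof
      assume s: "set s \<inter> set q = {}"
      have L': "link E q (rev p) a m b" using L by (simp add: link_rev_right)
      have "rev p = rev s @ b # rev l" using p by simp
      from outer_link_card[OF tri_rev[OF T] L' L(2,3) this] show False using s small by simp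
    qed
    ultimately show ?thesis by blast
  qed
  obtain a m b where L: "link E q p a m b" "a \<in> set r" "b \<in> set r" using ex_link[OF T] by metis
  obtain a' m' c where L': "link E r p a' m' c" "a' \<in> set q" "c \<in> set q"
    using ex_link[OF tri_swap23[OF T]] by metis
  obtain l s where p: "p = l @ b # s" using L by (auto simp: link_def dest: split_list)
  obtain l' s' where p': "p = l' @ c # s'" using L' by (auto simp: link_def dest: split_list)
  have "\<not> 13 * f \<le> card (set p \<union> set r \<union> set q) + 6" using small by (simp add: Un_ac)
  then show ?thesis
    using alt4I[OF T p _ _ _ p'] inner[OF T L p small] inner[OF tri_swap23[OF T] L' p'] L L' by blast
qed

text \<open>Exchanging the segment \<open>y\<close> of \<open>q\<close> for the detour
  \<open>w\<close> gives a path again.\<close>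

lemma detour_le:
  assumes q: "path q" "length q = N" "q = x @ c # y @ c' # z"
    and w: "path (c # w @ [c'])" "set w \<inter> set q = {}"
  shows "length w \<le> length y"
proof -
  have "path (x @ [c])" using q(1,3) path_sub[of "[]" "x @ [c]" "y @ c' # z"] by simp
  then have "path (x @ c # w @ [c'])"
    by (rule upath_join[OF _ w(1)]) (use q w in \<open>auto simp: upath_def\<close>)
  then have 1: "path ((x @ c # w) @ [c'])" by simp
  have 2: "path (c' # z)" using q(1,3) path_sub[of "x @ c # y" "c' # z" "[]"] by simp
  have "path ((x @ c # w) @ c' # z)"
    by (rule upath_join[OF 1 2]) (use q w in \<open>auto simp: upath_def\<close>)
  from bound[OF this] show ?thesis using q by simp
qed

text \<open>The link inside the segment must start at \<open>c\<close>, the only vertex of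
  \<open>q\<close> there, so \<open>link_sides\<close> applies to it on \<open>q\<close>.\<close>

lemma segment_sides:
  assumes T: "tri p q r" and p: "p = xs @ c # ys @ x # zs" "c \<in> set q" "x \<in> set r" "set ys \<inter> set q = {}"
    and q: "q = l @ c # s"
  shows "2 * f - 1 \<le> length l \<and> 2 * f - 1 \<le> length s"
proof -
  have x: "x \<notin> set q" using tri_disjoint[OF T, of x] p by auto
  have "tri r q p" using tri_swap[OF tri_rot[OF T]] .
  from link_on_segment[OF this p(1-3)] obtain u a m b v
    where *: "c # ys @ [x] = u @ a # m @ b # v" "link E q r a m b" "set (c # ys @ [x]) \<subseteq> set p"
    by metis
  have "a \<in> set (c # ys @ [x])" "b \<in> set (c # ys @ [x])" unfolding *(1) by auto
  moreover have "a \<in> set q" "b \<in> set r" using *(2) by (auto simp: link_def)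
  ultimately have "a = c" "a \<in> set p" "b \<in> set p" using x p(4) *(3) by auto
  then show ?thesis using link_sides[OF tri_rot[OF T] link_sym[OF *(2)], of l s] q by auto
qed

text \<open>Between the last vertex \<open>c\<close> of \<open>q\<close> before \<open>y\<close> and
  the first one \<open>c'\<close> after it, \<open>p\<close> makes a detour off \<open>q\<close>
  through at least \<open>(f - 1) + 1 + (f - 1)\<close> vertices. By exchange the segment of
  \<open>q\<close> between \<open>c\<close> and \<open>c'\<close> is no shorter, and
  \<open>segment_sides\<close> bounds the two ends of \<open>q\<close>.\<close>

lemma alternation_spread:
  assumes T: "tri p q r" and p: "p = A @ x # B @ y # C @ z # D" "x \<in> set q" "y \<in> set r" "z \<in> set q"
  obtains i j where "i + 2 * f \<le> j" "2 * f - 1 \<le> i" "j + 2 * f - 1 < N" "q ! i \<in> set p" "q ! j \<in> set p"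
proof -
  have pq: "path q" "length q = N" "distinct p" using T by (auto simp: tri_def upath_def)
  have y: "y \<notin> set q" using tri_disjoint[OF T, of y] p by auto
  have "\<exists>v\<in>set (A @ x # B). v \<in> set q" using p by simp
  then obtain A' c B' where c: "A @ x # B = A' @ c # B'" "c \<in> set q" "\<forall>v\<in>set B'. v \<notin> set q"
    by (rule split_list_last_propE) blast
  have "\<exists>v\<in>set (C @ z # D). v \<in> set q" using p by simp
  then obtain C' c' D' where c': "C @ z # D = C' @ c' # D'" "c' \<in> set q" "\<forall>v\<in>set C'. v \<notin> set q"
    by (rule split_list_first_propE) blast
  have "p = (A @ x # B) @ y # C @ z # D" using p by simp
  also have "\<dots> = A' @ c # B' @ y # C' @ c' # D'" unfolding c(1) c'(1) by simp
  finally have p': "p = A' @ c # B' @ y # C' @ c' # D'" .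
  let ?w = "B' @ y # C'"
  have w: "path (c # ?w @ [c'])" using T p' path_sub[of A' "c # ?w @ [c']" D'] by (auto simp: tri_def)
  have wq: "set ?w \<inter> set q = {}" using c c' y by auto
  have fB: "f \<le> length B' + 1" using segment_length[OF T p'] c p by auto
  have fC: "f \<le> length C' + 1" using segment_length[OF T, of "A' @ c # B'" y C' c' D'] p' c' p by auto
  have sc: "2 * f - 1 \<le> length l \<and> 2 * f - 1 \<le> length s" if "q = l @ c # s" for l s
    using segment_sides[OF T p' c(2) p(3) _ that] c by auto
  have sc': "2 * f - 1 \<le> length l \<and> 2 * f - 1 \<le> length s" if "q = l @ c' # s" for l s
    using segment_sides[OF tri_rev[OF T], of "rev D'" c' "rev C'" y "rev B' @ c # rev A'", OF _ c'(2) p(3) _ that]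
      p' c' by auto
  have "c \<noteq> c'" using pq p' by auto
  obtain u v where q: "q = u @ c # v" using c split_list by metis
  have "c' \<in> set v \<or> c' \<in> set u" using q c' \<open>c \<noteq> c'\<close> by auto
  \<comment> \<open>\<open>c\<close> and \<open>c'\<close> may come in either order on
    \<open>q\<close>; \<open>c1\<close> is the earlier one.\<close>
  then obtain x c1 g c2 h where g: "q = x @ c1 # g @ c2 # h" "{c1, c2} = {c, c'}" "length ?w \<le> length g"
  proof
    assume "c' \<in> set v"
    then obtain v1 v2 where "v = v1 @ c' # v2" using split_list by metis
    then have q': "q = u @ c # v1 @ c' # v2" using q by simp
    show thesis by (rule that[OF q']) (use detour_le[OF pq(1,2) q' w wq] in auto)
  next
    assume "c' \<in> set u"
    then obtain v1 v2 where "u = v1 @ c' # v2" using split_list by metis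
    then have q': "q = v1 @ c' # v2 @ c # v" using q by simp
    have "path (c' # rev ?w @ [c])" using path_rev[OF w] by simp
    then have "length (rev ?w) \<le> length v2" using detour_le[OF pq(1,2) q', of "rev ?w"] wq by auto
    then show thesis using that[OF q'] by auto
  qed
  have "c \<in> set p" "c' \<in> set p" using p' by auto
  then have "c1 \<in> set p" "c2 \<in> set p" using g(2) by (auto simp: doubleton_eq_iff)
  moreover have "q ! length x = c1" "q ! (length x + length g + 1) = c2"
    using g(1) by (auto simp: nth_append)
  moreover have "2 * f - 1 \<le> length x" "2 * f - 1 \<le> length h"
    using g(1,2) sc[of x "g @ c2 # h"] sc'[of x "g @ c2 # h"] sc[of "x @ c1 # g" h] sc'[of "x @ c1 # g" h]
    by (auto simp: doubleton_eq_iff)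
  moreover have "length x + length g + length h + 2 = N" using g(1) pq(2) by auto
  ultimately show thesis using that[of "length x" "length x + length g + 1"] g(3) fB fC f_pos by auto
qed

lemma card_union_tri:
  assumes T: "tri p q r"
  shows "13 * f \<le> card (set p \<union> set q \<union> set r) + 6"
proof (rule ccontr)
  assume small: "\<not> ?thesis"
  then have small': "\<not> 13 * f \<le> card (set r \<union> set q \<union> set p) + 6" by (simp add: Un_ac)
  have T': "tri r q p" using tri_swap[OF tri_rot[OF T]] .
  have alt: "alt4 p q r \<or> alt4 p r q" "alt4 r q p \<or> alt4 r p q"
    using small_alt4[OF T small] small_alt4[OF T' small'] by auto
  have spread: "\<exists>i j. i + 2 * f \<le> j \<and> 2 * f - 1 \<le> i \<and> j + 2 * f - 1 < N \<and> q ! i \<in> set p \<and> q ! j \<in> set p"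
    if T: "tri p q r" and "alt4 p q r \<or> alt4 p r q" for p r
    using that(2)
  proof
    assume "alt4 p q r"
    then obtain A x B y C z D w F where "p = A @ x # B @ y # C @ z # D @ w # F"
      "x \<in> set q" "y \<in> set r" "z \<in> set q" unfolding alt4_def by blast
    then show ?thesis using alternation_spread[OF T] by metis
  next
    assume "alt4 p r q"
    \<comment> \<open>This alternation starts on \<open>r\<close>; its first vertex is put into the
      initial part, which leaves the order \<open>q\<close>, \<open>r\<close>,
      \<open>q\<close>.\<close>
    then obtain A x B y C z D w F where "p = (A @ x # B) @ y # C @ z # D @ w # F"
      "y \<in> set q" "z \<in> set r" "w \<in> set q" unfolding alt4_def by fastforce
    then show ?thesis using alternation_spread[OF T] by metis
  qed
  obtain i j where ij: "i + 2 * f \<le> j" "2 * f - 1 \<le> i" "j + 2 * f - 1 < N" "q ! i \<in> set p" "q ! j \<in> set p"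
    using spread[OF T alt(1)] by blast
  obtain k l where kl: "k + 2 * f \<le> l" "2 * f - 1 \<le> k" "l + 2 * f - 1 < N" "q ! k \<in> set r" "q ! l \<in> set r"
    using spread[OF T' alt(2)] by blast
  note d = index_dist[OF tri_swap[OF T]]
  have "i < N" "j < N" "k < N" "l < N" using ij kl f_pos by auto
  then have "i + f \<le> k \<or> k + f \<le> i" "i + f \<le> l \<or> l + f \<le> i" "j + f \<le> k \<or> k + f \<le> j" "j + f \<le> l \<or> l + f \<le> j"
    using d ij kl by auto
  \<comment> \<open>The four positions are closest together when the pairs interlock, as in
    \<open>i < k < j < l\<close>: then they still span \<open>2 * f + f\<close> edges of
    \<open>q\<close>, and \<open>2 * f - 1\<close> vertices remain at either end.\<close>
  then have N: "7 * f - 1 \<le> N" using ij(1-3) kl(1-3) f_pos by linarith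
  have "set p \<inter> set r \<noteq> {}" using T by (simp add: tri_def)
  then have "1 \<le> card (set p \<inter> set r)" by (simp add: Suc_leI card_gt_0_iff)
  moreover have "3 * (f - 1) \<le> card (set p - set q - set r)" using private_alt4[OF T alt(1)] .
  moreover have "3 * (f - 1) \<le> card (set r - set q - set p)" using private_alt4[OF T' alt(2)] .
  moreover have "N + card (set p \<inter> set r) + card (set p - set q - set r) + card (set r - set q - set p) \<le>
     card (set p \<union> set q \<union> set r)"
  proof -
    have "distinct q" "length q = N" using T by (auto simp: tri_def upath_def)
    then have "N + card (set p \<inter> set r) + card (set p - set q - set r) + card (set r - set q - set p) =
      card (set q) + card (set p \<inter> set r) + card (set p - set q - set r) + card (set r - set q - set p)"
      by (simp add: distinct_card)
    \<comment> \<open>\<open>q\<close> is disjoint from the intersection of \<open>p\<close> and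
      \<open>r\<close> because no vertex lies on all three paths.\<close>
    also have "\<dots> = card (set q \<union> (set p \<inter> set r) \<union> (set p - set q - set r) \<union> (set r - set q - set p))"
      using tri_disjoint[OF T] by (subst card_Un_disjoint | auto)+
    also have "\<dots> \<le> card (set p \<union> set q \<union> set r)" by (rule card_mono) auto
    finally show ?thesis .
  qed
  ultimately show False using small N f_pos by simp
qed

section \<open>Any two longest paths meet\<close>

text \<open>If they were disjoint, a link between them followed by the longer side of its end on
  \<open>p\<close> would be a hair on \<open>q\<close> with more than \<open>N / 2\<close> vertices.
  By \<open>hair_le\<close> it would fit into both sides of \<open>b\<close>, which is
  impossible.\<close>

lemma longest_paths_meet:
  assumes p: "path p" "length p = N" "p \<noteq> []" and q: "path q" "length q = N" "q \<noteq> []"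
    and conn: "\<And>x y. x \<in> set p \<Longrightarrow> y \<in> set q \<Longrightarrow> \<exists>xs. path xs \<and> xs \<noteq> [] \<and> hd xs = x \<and> last xs = y"
  shows "set p \<inter> set q \<noteq> {}"
proof
  assume disj: "set p \<inter> set q = {}"
  have xy: "hd p \<in> set p" "hd q \<in> set q" using p q by auto
  then obtain xs where xs: "path xs" "xs \<noteq> []" "hd xs = hd p" "last xs = hd q" using conn by blast
  have "hd p \<noteq> hd q" using xy disj by auto
  then have "tl xs \<noteq> []" using xs by (cases xs) auto
  moreover from this have "last (tl xs) = hd q" using xs by (simp add: last_tl)
  ultimately have "tl xs = butlast (tl xs) @ [hd q]" by (metis append_butlast_last_id)
  then obtain ys where "xs = hd p # ys @ [hd q]" using xs by (metis list.collapse)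
  then have "path (hd p # ys @ [hd q])" using xs by simp
  moreover have "set (hd p # ys @ [hd q]) \<inter> set p \<inter> set q = {}" using disj by blast
  ultimately obtain a m b where L: "link E p q a m b" using link_in_list[OF _ xy] by metis
  have ab: "a \<in> set p" "b \<in> set q" "a \<notin> set q" "b \<notin> set p" using L disj by (auto simp: link_def)
  obtain l s where ls: "p = l @ a # s" using ab split_list by metis
  obtain l' s' where ls': "q = l' @ b # s'" using ab split_list by metis
  have "path (l @ [a])" "path (a # s)"
    using p(1) ls path_sub[of "[]" "l @ [a]" s] path_sub[of l "a # s" "[]"] by auto
  then have "path (a # rev l)" "path (a # s)" using path_rev[of "l @ [a]"] by auto
  have "N \<le> 2 * length (rev l) + 1 \<or> N \<le> 2 * length s + 1" using p(2) ls by auto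
  then obtain h where h: "path (a # h)" "set h \<subseteq> set p" "N \<le> 2 * length h + 1"
  proof (elim disjE)
    assume "N \<le> 2 * length (rev l) + 1"
    then show thesis using that[of "rev l"] \<open>path (a # rev l)\<close> ls by auto
  next
    assume "N \<le> 2 * length s + 1"
    then show thesis using that[of s] \<open>path (a # s)\<close> ls by auto
  qed
  have "length (rev m @ a # h) \<le> length l' \<and> length (rev m @ a # h) \<le> length s'"
  proof -
    have "set h \<inter> set q = {}" "set h \<inter> set (rev m) = {}"
      using h(2) L disj by (auto simp: link_def)
    moreover from this have "path (b # rev m @ a # h)"
      using link_hair(1)[OF link_sym[OF L] h(1)] ab h(2) disj by blast
    moreover have "set (rev m @ a # h) \<inter> set q = {}"
      using L ab calculation by (auto simp: link_def)
    ultimately show ?thesis using hair_le[OF q(1,2) ls'] by blast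
  qed
  then show False using h(3) q(2) ls' by auto
qed

end

section \<open>Transfer from digraphs to vertex lists\<close>

lemma set_vwalk_arcs_subset_iff:
  "set (vwalk_arcs p) \<subseteq> A \<longleftrightarrow> successively (\<lambda>x y. (x, y) \<in> A) p"
  by (induction p rule: vwalk_arcs.induct) auto

lemma vpath_with_proj_iff:
  "vpath p (with_proj G) \<longleftrightarrow> p \<noteq> [] \<and> set p \<subseteq> pverts G \<and> upath (\<lambda>x y. (x, y) \<in> parcs G) p"
  by (auto simp: vpath_def vwalk_def upath_def set_vwalk_arcs_subset_iff)

lemma (in pair_wf_digraph) successively_in_pverts:
  "successively (\<lambda>x y. (x, y) \<in> parcs G) (x # xs) \<Longrightarrow> x \<in> pverts G \<Longrightarrow> set xs \<subseteq> pverts G"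
  by (induction xs arbitrary: x) (use in_arcsD2 in auto)

text \<open>\<open>upath\<close> does not mention the vertex set of \<open>G\<close>. From two
  vertices on, the arcs force the list into \<open>G\<close>; shorter lists satisfy the bound
  anyway.\<close>

lemma (in pair_graph) longest_vpath_bound:
  assumes "upath (\<lambda>x y. (x, y) \<in> parcs G) xs"
  shows "length xs \<le> longest_path_length G + 1"
proof (cases xs)
  case (Cons x ys)
  show ?thesis
  proof (cases ys)
    case (Cons y zs)
    have "x \<in> pverts G" using assms Cons \<open>xs = x # ys\<close> in_arcsD1 by (auto simp: upath_def)
    then have "vpath xs (with_proj G)"
      using assms successively_in_pverts[of x ys] \<open>xs = x # ys\<close>
      by (auto simp: vpath_with_proj_iff upath_def)
    \<comment> \<open>\<open>Max\<close> needs a finite set: a path repeats no vertex, so its length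
      is bounded by the order of \<open>G\<close>.\<close>
    moreover have "finite {vwalk_length p | p. vpath p (with_proj G)}"
    proof -
      have "length p \<le> card (pverts G)" if "vpath p (with_proj G)" for p
        using that pair_finite_verts
        by (metis card_mono distinct_card vpath_with_proj_iff upath_def)
      then have "{vwalk_length p | p. vpath p (with_proj G)} \<subseteq> {.. card (pverts G)}"
        by (fastforce simp: le_diff_conv trans_le_add1)
      then show ?thesis using finite_subset by blast
    qed
    ultimately have "vwalk_length xs \<le> longest_path_length G"
      unfolding longest_path_length_def by (intro Max_ge) auto
    then show ?thesis by simp
  qed (use Cons in simp)
qed simp

lemma longest_pathsE:
  assumes "P \<in> longest_paths G"
  obtains p where "pverts P = set p" "vpath p (with_proj G)" "length p = longest_path_length G + 1"
proof -
  from assms obtain p where p: "P = path_subgraph p" "vpath p (with_proj G)"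
    "card (pverts P) = longest_path_length G + 1" by (auto simp: longest_paths_def paths_def)
  then have "pverts P = set p" "distinct p" by (auto simp: path_subgraph_def)
  then show ?thesis using that[of p] p by (simp add: distinct_card)
qed

lemma vdist_le:
  assumes "vpath p (with_proj G)"
  shows "vdist G (hd p) (last p) \<le> length p - 1"
  unfolding vdist_def by (rule Least_le) (use assms in auto)

lemma vdist_set_le:
  assumes "finite U" "y \<in> U" shows "vdist_set G x U \<le> vdist G x y"
  unfolding vdist_set_def by (rule Min_le) (use assms in auto)

lemma vdist_set_self:
  assumes "finite U" "x \<in> U" "x \<in> pverts G" shows "vdist_set G x U = 0"
proof -
  have "vpath [x] (with_proj G)" using assms by (simp add: vpath_with_proj_iff upath_def)
  from vdist_le[OF this] show ?thesis using vdist_set_le[OF assms(1,2), of G x] by simp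
qed

lemma min_total_dist_le:
  assumes "finite (pverts G)" "v \<in> pverts G"
  shows "min_total_dist G Ps \<le> (\<Sum>P\<in>Ps. vdist_set G v (pverts P))"
  unfolding min_total_dist_def by (rule Min_le) (use assms in auto)

text \<open>This provides \<open>apart\<close>. The total distance is evaluated at
  \<open>hd xs\<close>, where the terms of \<open>P\<close> and \<open>Q\<close> vanish and
  \<open>xs\<close> itself bounds the term of \<open>R\<close>.\<close>

lemma (in pair_graph) min_total_dist_less_length:
  assumes xs: "upath (\<lambda>x y. (x, y) \<in> parcs G) xs" "xs \<noteq> []"
    and P: "P \<noteq> Q" "P \<noteq> R" "Q \<noteq> R" "pverts P \<subseteq> pverts G" "pverts Q \<subseteq> pverts G" "pverts R \<subseteq> pverts G"
    and "hd xs \<in> pverts P" "hd xs \<in> pverts Q" "last xs \<in> pverts R"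
  shows "min_total_dist G {P, Q, R} < length xs"
proof -
  have fin: "finite (pverts P)" "finite (pverts Q)" "finite (pverts R)"
    using P pair_finite_verts finite_subset by blast+
  have v: "hd xs \<in> pverts G" using assms by blast
  then have path: "vpath xs (with_proj G)"
    using xs successively_in_pverts[of "hd xs" "tl xs"]
    by (cases xs) (auto simp: vpath_with_proj_iff upath_def)
  have "min_total_dist G {P, Q, R} \<le> (\<Sum>P\<in>{P, Q, R}. vdist_set G (hd xs) (pverts P))"
    by (rule min_total_dist_le[OF pair_finite_verts v])
  also have "\<dots> = vdist_set G (hd xs) (pverts R)"
    using P vdist_set_self[OF fin(1) assms(9) v] vdist_set_self[OF fin(2) assms(10) v] by simp
  also have "\<dots> \<le> length xs - 1"
    using vdist_set_le[OF fin(3) assms(11)] vdist_le[OF path] le_trans by blast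
  finally show ?thesis using xs(2) by (cases xs) auto
qed

theorem theorem1:
  fixes G :: "'a pair_pre_digraph" and n :: nat
    and Ps :: "'a pair_pre_digraph set"
  assumes "pair_graph G"
    and "Digraph_Component.connected (with_proj G)"
    and "card (pverts G) = n"
    and "Ps \<subseteq> longest_paths G"
    and "card Ps = 3"
  shows "real (min_total_dist G Ps) \<le> (real n + 6) / 13"
proof (cases "min_total_dist G Ps = 0")
  \<comment> \<open>For minimum 0 the bound is trivial; a positive minimum is what
    \<open>f_pos\<close> asks for.\<close>
  case False
  interpret pair_graph G by fact
  let ?E = "\<lambda>x y. (x, y) \<in> parcs G" and ?N = "longest_path_length G + 1"
  interpret path_bound ?E ?N "min_total_dist G Ps"
    by unfold_locales (use arcs_symmetric longest_vpath_bound False in auto)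
  obtain P Q R where Ps: "Ps = {P, Q, R}" and ne: "P \<noteq> Q" "P \<noteq> R" "Q \<noteq> R"
    using assms(5) by (auto simp: card_3_iff)
  obtain p where p: "pverts P = set p" "vpath p (with_proj G)" "length p = ?N"
    using longest_pathsE assms(4) Ps by (metis insertI1 subsetD)
  obtain q where q: "pverts Q = set q" "vpath q (with_proj G)" "length q = ?N"
    using longest_pathsE assms(4) Ps by (metis insertI1 insertI2 subsetD)
  obtain r where r: "pverts R = set r" "vpath r (with_proj G)" "length r = ?N"
    using longest_pathsE assms(4) Ps by (metis insertI1 insertI2 subsetD)
  have conn: "\<exists>xs. upath ?E xs \<and> xs \<noteq> [] \<and> hd xs = x \<and> last xs = y"
    if "x \<in> pverts G" "y \<in> pverts G" for x y
  proof -
    have "x \<rightarrow>\<^sup>*\<^bsub>with_proj (mk_symmetric (with_proj G))\<^esub> y"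
      using assms(2) that by (auto simp: connected_def strongly_connected_def)
    \<comment> \<open>Connectedness refers to the symmetric closure; the arcs of \<open>G\<close>
      are already symmetric, so reachability is the same.\<close>
    then have "x \<rightarrow>\<^sup>*\<^bsub>with_proj G\<^esub> y" using reachable_mk_symmetric_eq sym_arcs by blast
    then show ?thesis unfolding reachable_vpath_conv vpath_with_proj_iff by blast
  qed
  have meet: "set x \<inter> set y \<noteq> {}"
    if "vpath x (with_proj G)" "length x = ?N" "vpath y (with_proj G)" "length y = ?N" for x y
    using that by (intro longest_paths_meet conn) (auto simp: vpath_with_proj_iff)
  have sub: "pverts P \<subseteq> pverts G" "pverts Q \<subseteq> pverts G" "pverts R \<subseteq> pverts G"
    using p q r by (auto simp: vpath_with_proj_iff)
  have perm: "Ps = {Q, R, P}" "Ps = {P, R, Q}" using Ps by auto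
  have "apart p q r"
    using min_total_dist_less_length[OF _ _ ne sub, folded Ps] p q r
    unfolding apart_def by auto
  moreover have "apart q r p"
    using min_total_dist_less_length[OF _ _ ne(3) ne(1)[symmetric] ne(2)[symmetric] sub(2,3,1), folded perm(1)] p q r
    unfolding apart_def by auto
  moreover have "apart p r q"
    using min_total_dist_less_length[OF _ _ ne(2,1) ne(3)[symmetric] sub(1,3,2), folded perm(2)] p q r
    unfolding apart_def by auto
  ultimately have "tri p q r"
    unfolding tri_def using p q r meet by (auto simp: vpath_with_proj_iff)
  then have "13 * min_total_dist G Ps \<le> card (set p \<union> set q \<union> set r) + 6"
    by (rule card_union_tri)
  also have "card (set p \<union> set q \<union> set r) \<le> n"
    using sub p q r pair_finite_verts assms(3) by (metis Un_least card_mono)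
  finally show ?thesis by simp
qed simp

end
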